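(* Let $ABCD$ be a convex quadrilateral and let $E$ be its diagonal point. Let $F$, $G$, $H$, and $I$ be the $X_{20}$ points of $\triangle EAB$, $\triangle EBC$, $\triangle ECD$, and $\triangle EDA$, respectively. Then $FGHI$ is a parallelogram and $$[ABCD]=\frac12[FGHI].$$
   Context: The diagonal point of a quadrilateral $ABCD$ is the intersection of its diagonals $AC$ and $BD$. The $X_{20}$ point (de Longchamps point) of a triangle is the reflection of its orthocenter in its circumcenter; equivalently, in a triangle with side lengths $a,b,c$ (opposite the vertices $A,B,C$) it has barycentric coordinates $(g(a,b,c):g(b,c,a):g(c,a,b))$ with $g(a,b,c)=3a^4-2a^2b^2-2a^2c^2-b^4+2b^2c^2-c^4$. $[XYZW]$ denotes the area of the quadrilateral $XYZW$; in general it is the signed area $[XYZW]=[XYZ]+[ZWX]$ (orientation taken positive for the orientation of $ABCD$). *)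

theory Defs
  imports "HOL-Analysis.Analysis"
begin

definition signed_triangle_area :: "real^2 \<Rightarrow> real^2 \<Rightarrow> real^2 \<Rightarrow> real" where
  "signed_triangle_area X Y Z =
     ((Y$1 - X$1) * (Z$2 - X$2) - (Y$2 - X$2) * (Z$1 - X$1)) / 2"

lemma abs_signed_triangle_area:
  "\<bar>signed_triangle_area X Y Z\<bar> = measure lborel (convex hull {X, Y, Z})"
  unfolding content_triangle signed_triangle_area_def by (simp add: abs_if field_simps)

definition signed_quad_area :: "real^2 \<Rightarrow> real^2 \<Rightarrow> real^2 \<Rightarrow> real^2 \<Rightarrow> real" where
  "signed_quad_area X Y Z W = signed_triangle_area X Y Z + signed_triangle_area Z W X"

(* 1 for a counterclockwise quadrilateral, -1 for a clockwise one *)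
definition quad_orientation :: "real^2 \<Rightarrow> real^2 \<Rightarrow> real^2 \<Rightarrow> real^2 \<Rightarrow> real" where
  "quad_orientation A B C D = sgn (signed_quad_area A B C D)"

(* P and Q lie strictly on the same side of the line XY (in particular, X and Y are distinct) *)
definition same_side :: "real^2 \<Rightarrow> real^2 \<Rightarrow> real^2 \<Rightarrow> real^2 \<Rightarrow> bool" where
  "same_side X Y P Q \<longleftrightarrow> signed_triangle_area X Y P * signed_triangle_area X Y Q > 0"

(* Each side line has the two remaining vertices strictly on one side; this excludes
   self-crossing quadrilaterals and angles of 0 or 180 degrees. *)
definition convex_quadrilateral :: "real^2 \<Rightarrow> real^2 \<Rightarrow> real^2 \<Rightarrow> real^2 \<Rightarrow> bool" where
  "convex_quadrilateral A B C D \<longleftrightarrow>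
     same_side A B C D \<and> same_side B C D A \<and> same_side C D A B \<and> same_side D A B C"

definition diagonal_point :: "real^2 \<Rightarrow> real^2 \<Rightarrow> real^2 \<Rightarrow> real^2 \<Rightarrow> real^2" where
  "diagonal_point A B C D = (THE E. E \<in> closed_segment A C \<and> E \<in> closed_segment B D)"

definition circumcenter :: "real^2 \<Rightarrow> real^2 \<Rightarrow> real^2 \<Rightarrow> real^2" where
  "circumcenter A B C = (THE P. dist P A = dist P B \<and> dist P B = dist P C)"

definition orthocenter :: "real^2 \<Rightarrow> real^2 \<Rightarrow> real^2 \<Rightarrow> real^2" where
  "orthocenter A B C =
     (THE P. orthogonal (P - A) (B - C) \<and> orthogonal (P - B) (C - A) \<and> orthogonal (P - C) (A - B))"

(* The de Longchamps point: the reflection of the orthocenter in the circumcenter. *)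
definition X20 :: "real^2 \<Rightarrow> real^2 \<Rightarrow> real^2 \<Rightarrow> real^2" where
  "X20 A B C = 2 *\<^sub>R circumcenter A B C - orthocenter A B C"

definition parallel :: "real^2 \<Rightarrow> real^2 \<Rightarrow> real^2 \<Rightarrow> real^2 \<Rightarrow> bool" where
  "parallel P Q R S \<longleftrightarrow> collinear {0, Q - P, S - R}"

(* The first conjunct makes the parallelogram nondegenerate. *)
definition parallelogram :: "real^2 \<Rightarrow> real^2 \<Rightarrow> real^2 \<Rightarrow> real^2 \<Rightarrow> bool" where
  "parallelogram P Q R S \<longleftrightarrow>
     convex_quadrilateral P Q R S \<and> parallel P Q S R \<and> parallel Q R P S"

end

theory Submission
  imports Defs
begin

text \<open>
  Write \<open>u = C - A\<close> and \<open>v = D - B\<close> for the two diagonals.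

  The de Longchamps point \<open>L = 2O - K\<close> of a triangle \<open>EPQ\<close> is described by two \<^emph>\<open>linear\<close> equations.
  The circumcenter \<open>O\<close> has scalar product \<open>|P - E|\<^sup>2 / 2\<close> with the side \<open>P - E\<close> (measured from \<open>E\<close>),
  while the orthocenter \<open>K\<close> has scalar product \<open>(P - E) \<bullet> (Q - E)\<close> with it; hence
  \<open>(L - E) \<bullet> (P - E) = (P - E) \<bullet> (P - Q)\<close>, and likewise with \<open>P\<close> and \<open>Q\<close> exchanged
  (lemma \<open>X20_inner\<close>).

  The four triangles have all their sides at \<open>E\<close> along \<open>u\<close> or \<open>v\<close>, so these equations give the
  scalar products of \<open>F\<close>, \<open>G\<close>, \<open>H\<close>, \<open>I\<close> with \<open>u\<close> and \<open>v\<close>. In the difference of two neighbouring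
  points the position of \<open>E\<close> on the diagonals cancels (lemma \<open>X20_diff_inner\<close>): both \<open>G - F\<close> and
  \<open>H - I\<close> are the vector \<open>p\<close> with \<open>p \<bullet> u = u \<bullet> u\<close> and \<open>p \<bullet> v = - (u \<bullet> v)\<close>, and \<open>H - G\<close> is the
  vector \<open>q\<close> with \<open>q \<bullet> u = - (u \<bullet> v)\<close> and \<open>q \<bullet> v = v \<bullet> v\<close>. So \<open>FGHI\<close> is a parallelogram. Its
  signed area is the cross product of \<open>p\<close> and \<open>q\<close>; multiplied by the cross product of \<open>u\<close> and \<open>v\<close>
  it becomes the determinant \<open>(u \<bullet> u) (v \<bullet> v) - (u \<bullet> v)\<^sup>2\<close>, which is the square of that
  same cross product (lemma \<open>cross2_gram\<close>). Therefore \<open>p\<close> and \<open>q\<close> span the same signed area as the diagonals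
  \<open>u\<close> and \<open>v\<close>, which is twice the signed area of \<open>ABCD\<close>.
\<close>

section \<open>Scalar and cross products in the plane\<close>

definition cross2 :: "real^2 \<Rightarrow> real^2 \<Rightarrow> real" where
  "cross2 p q = p$1 * q$2 - p$2 * q$1"

lemma inner_real2: "x \<bullet> y = x$1 * y$1 + x$2 * y$2" for x y :: "real^2"
  by (simp add: inner_vec_def sum_2)

lemma cross2_scaleR [simp]:
  "cross2 (a *\<^sub>R p) q = a * cross2 p q" "cross2 p (a *\<^sub>R q) = a * cross2 p q"
  by (simp_all add: cross2_def algebra_simps)

lemma cross2_minus [simp]: "cross2 (- p) q = - cross2 p q" "cross2 p (- q) = - cross2 p q"
  by (simp_all add: cross2_def algebra_simps)

lemma cross2_commute: "cross2 p q = - cross2 q p"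
  by (simp add: cross2_def algebra_simps)

lemma signed_triangle_area_cross2: "signed_triangle_area X Y Z = cross2 (Y - X) (Z - X) / 2"
  by (simp add: signed_triangle_area_def cross2_def)

lemma signed_quad_area_cross2: "signed_quad_area X Y Z W = cross2 (Z - X) (W - Y) / 2"
  by (simp add: signed_quad_area_def signed_triangle_area_def cross2_def field_simps)

lemma cross2_gram: "cross2 p q * cross2 u v = (p \<bullet> u) * (q \<bullet> v) - (p \<bullet> v) * (q \<bullet> u)"
  by (simp add: cross2_def inner_real2 algebra_simps)

text \<open>
  Cramer's rule, with vectors measured from a base point \<open>E\<close>.
\<close>

lemma ex1_inner_inner:
  assumes "cross2 p q \<noteq> 0"
  shows "\<exists>!x. (x - E) \<bullet> p = \<alpha> \<and> (x - E) \<bullet> q = \<beta>"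
proof
  let ?w = "vector [\<alpha> * q$2 - \<beta> * p$2, \<beta> * p$1 - \<alpha> * q$1] :: real^2"
  have "?w \<bullet> p = \<alpha> * cross2 p q" "?w \<bullet> q = \<beta> * cross2 p q"
    by (simp_all add: inner_real2 cross2_def algebra_simps)
  then show "((E + (1 / cross2 p q) *\<^sub>R ?w) - E) \<bullet> p = \<alpha> \<and>
      ((E + (1 / cross2 p q) *\<^sub>R ?w) - E) \<bullet> q = \<beta>"
    using assms by simp
next
  fix x
  assume x: "(x - E) \<bullet> p = \<alpha> \<and> (x - E) \<bullet> q = \<beta>"
  have "cross2 p q * y$1 = (y \<bullet> p) * q$2 - (y \<bullet> q) * p$2"
    "cross2 p q * y$2 = (y \<bullet> q) * p$1 - (y \<bullet> p) * q$1" for y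
    by (simp_all add: inner_real2 cross2_def algebra_simps)
  from this [of "x - E"] have "cross2 p q * (x - E)$1 = \<alpha> * q$2 - \<beta> * p$2"
    "cross2 p q * (x - E)$2 = \<beta> * p$1 - \<alpha> * q$1"
    using x by simp_all
  then have "(x - E)$1 = (\<alpha> * q$2 - \<beta> * p$2) / cross2 p q"
    "(x - E)$2 = (\<beta> * p$1 - \<alpha> * q$1) / cross2 p q"
    using assms by (simp_all add: field_simps)
  then show "x = E + (1 / cross2 p q) *\<^sub>R (vector [\<alpha> * q$2 - \<beta> * p$2, \<beta> * p$1 - \<alpha> * q$1] :: real^2)"
    by (simp add: vec_eq_iff forall_2 algebra_simps)
qed

lemma eq_if_inner_eq:
  assumes "cross2 u v \<noteq> 0" "x \<bullet> u = y \<bullet> u" "x \<bullet> v = y \<bullet> v"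
  shows "x = y"
  using ex1_inner_inner [OF assms(1), of 0 "y \<bullet> u" "y \<bullet> v"] assms(2,3) by auto

section \<open>Triangle centers as solutions of linear equations\<close>

text \<open>
  Squaring turns equality of distances to \<open>E\<close> and \<open>P\<close> into a linear condition, because the
  quadratic terms cancel.
\<close>

lemma dist_eq_iff_inner:
  fixes O' E P :: "'a :: real_inner"
  shows "dist O' E = dist O' P \<longleftrightarrow> (O' - E) \<bullet> (P - E) = (P - E) \<bullet> (P - E) / 2"
proof -
  have "dist O' E = dist O' P \<longleftrightarrow> (dist O' E)\<^sup>2 = (dist O' P)\<^sup>2"
    by simp
  also have "\<dots> \<longleftrightarrow> (O' - E) \<bullet> (P - E) = (P - E) \<bullet> (P - E) / 2"
    by (auto simp: dist_norm power2_norm_eq_inner algebra_simps inner_commute)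
  finally show ?thesis .
qed

lemma circumcenter_inner:
  assumes "cross2 (P - E) (Q - E) \<noteq> 0"
  shows "(circumcenter E P Q - E) \<bullet> (P - E) = (P - E) \<bullet> (P - E) / 2"
    and "(circumcenter E P Q - E) \<bullet> (Q - E) = (Q - E) \<bullet> (Q - E) / 2"
proof -
  have eq: "dist X E = dist X P \<and> dist X P = dist X Q \<longleftrightarrow>
      (X - E) \<bullet> (P - E) = (P - E) \<bullet> (P - E) / 2 \<and> (X - E) \<bullet> (Q - E) = (Q - E) \<bullet> (Q - E) / 2" for X
    using dist_eq_iff_inner [of X E P] dist_eq_iff_inner [of X E Q] by auto
  show "(circumcenter E P Q - E) \<bullet> (P - E) = (P - E) \<bullet> (P - E) / 2"
    and "(circumcenter E P Q - E) \<bullet> (Q - E) = (Q - E) \<bullet> (Q - E) / 2"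
    unfolding circumcenter_def eq
    using theI' [OF ex1_inner_inner [OF assms,
      of E "(P - E) \<bullet> (P - E) / 2" "(Q - E) \<bullet> (Q - E) / 2"]] by blast+
qed

lemma orthocenter_inner:
  assumes "cross2 (P - E) (Q - E) \<noteq> 0"
  shows "(orthocenter E P Q - E) \<bullet> (P - E) = (P - E) \<bullet> (Q - E)"
    and "(orthocenter E P Q - E) \<bullet> (Q - E) = (P - E) \<bullet> (Q - E)"
proof -
  \<comment> \<open>The altitudes from \<open>P\<close> and \<open>Q\<close> give the two equations; their difference is the altitude
    from \<open>E\<close>.\<close>
  have eq: "orthogonal (X - E) (P - Q) \<and> orthogonal (X - P) (Q - E) \<and> orthogonal (X - Q) (E - P) \<longleftrightarrow>
      (X - E) \<bullet> (P - E) = (P - E) \<bullet> (Q - E) \<and> (X - E) \<bullet> (Q - E) = (P - E) \<bullet> (Q - E)" for X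
    by (auto simp: orthogonal_def algebra_simps inner_commute)
  show "(orthocenter E P Q - E) \<bullet> (P - E) = (P - E) \<bullet> (Q - E)"
    and "(orthocenter E P Q - E) \<bullet> (Q - E) = (P - E) \<bullet> (Q - E)"
    unfolding orthocenter_def eq
    using theI' [OF ex1_inner_inner [OF assms,
      of E "(P - E) \<bullet> (Q - E)" "(P - E) \<bullet> (Q - E)"]] by blast+
qed

lemma X20_inner:
  assumes "cross2 (P - E) (Q - E) \<noteq> 0"
  shows "(X20 E P Q - E) \<bullet> (P - E) = (P - E) \<bullet> (P - Q)"
    and "(X20 E P Q - E) \<bullet> (Q - E) = (Q - E) \<bullet> (Q - P)"
proof -
  have split: "X20 E P Q - E = 2 *\<^sub>R (circumcenter E P Q - E) - (orthocenter E P Q - E)"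
    by (simp add: X20_def algebra_simps scaleR_2)
  show "(X20 E P Q - E) \<bullet> (P - E) = (P - E) \<bullet> (P - Q)"
    and "(X20 E P Q - E) \<bullet> (Q - E) = (Q - E) \<bullet> (Q - P)"
    unfolding split inner_diff_left [of "2 *\<^sub>R _"] inner_scaleR_left
      circumcenter_inner [OF assms] orthocenter_inner [OF assms]
    by (simp_all add: inner_diff_left inner_diff_right inner_commute field_simps)
qed

lemma X20_swap: "X20 E Q P = X20 E P Q"
proof -
  have "(dist X E = dist X Q \<and> dist X Q = dist X P) = (dist X E = dist X P \<and> dist X P = dist X Q)" for X
    by auto
  moreover have "(orthogonal (X - E) (Q - P) \<and> orthogonal (X - Q) (P - E) \<and> orthogonal (X - P) (E - Q)) =
      (orthogonal (X - E) (P - Q) \<and> orthogonal (X - P) (Q - E) \<and> orthogonal (X - Q) (E - P))" for X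
    by (auto simp: orthogonal_def algebra_simps)
  ultimately show ?thesis
    by (simp add: X20_def circumcenter_def orthocenter_def)
qed

text \<open>
  Coefficients are allowed to have any sign, so that this single statement applies to all four triangles
  around the diagonal point.
\<close>

lemma X20_inner_scaled:
  assumes "cross2 u v \<noteq> 0" "a \<noteq> 0" "b \<noteq> 0"
  shows "(X20 E (E + a *\<^sub>R u) (E + b *\<^sub>R v) - E) \<bullet> u = a * (u \<bullet> u) - b * (u \<bullet> v)"
    and "(X20 E (E + a *\<^sub>R u) (E + b *\<^sub>R v) - E) \<bullet> v = b * (v \<bullet> v) - a * (u \<bullet> v)"
proof -
  let ?L = "X20 E (E + a *\<^sub>R u) (E + b *\<^sub>R v) - E"
  have nz: "cross2 ((E + a *\<^sub>R u) - E) ((E + b *\<^sub>R v) - E) \<noteq> 0"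
    using assms by simp
  have "a * (?L \<bullet> u) = a * (a * (u \<bullet> u) - b * (u \<bullet> v))"
    using X20_inner(1) [OF nz] by (simp add: inner_diff_right algebra_simps)
  then show "?L \<bullet> u = a * (u \<bullet> u) - b * (u \<bullet> v)"
    using assms by simp
  have "b * (?L \<bullet> v) = b * (b * (v \<bullet> v) - a * (u \<bullet> v))"
    using X20_inner(2) [OF nz] by (simp add: inner_diff_right inner_commute algebra_simps)
  then show "?L \<bullet> v = b * (v \<bullet> v) - a * (u \<bullet> v)"
    using assms by simp
qed

text \<open>
  The apex \<open>E\<close> and the side along \<open>v\<close> are common to the two triangles; when the other vertex moves
  along \<open>u\<close>, the displacement of the de Longchamps point is proportional to that of the vertex, and
  does not depend on \<open>b\<close>.
\<close>

lemma X20_diff_inner: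
  assumes "cross2 u v \<noteq> 0" "a \<noteq> 0" "a' \<noteq> 0" "b \<noteq> 0"
  shows "(X20 E (E + a' *\<^sub>R u) (E + b *\<^sub>R v) - X20 E (E + a *\<^sub>R u) (E + b *\<^sub>R v)) \<bullet> u = (a' - a) * (u \<bullet> u)"
    and "(X20 E (E + a' *\<^sub>R u) (E + b *\<^sub>R v) - X20 E (E + a *\<^sub>R u) (E + b *\<^sub>R v)) \<bullet> v = - (a' - a) * (u \<bullet> v)"
  using X20_inner_scaled [OF assms(1,2,4), of E] X20_inner_scaled [OF assms(1,3,4), of E]
  by (simp_all add: algebra_simps)

section \<open>Convex quadrilaterals\<close>

text \<open>
  The diagonal point divides \<open>AC\<close> in the ratio of the areas of \<open>DAB\<close> and \<open>BCD\<close>, and \<open>BD\<close> in the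
  ratio of the areas of \<open>ABC\<close> and \<open>CDA\<close>. Convexity makes these four signed areas
  nonzero and of equal sign, so the point lies strictly inside both diagonals.
\<close>

lemma convex_quadrilateral_diagonals:
  assumes "convex_quadrilateral A B C D"
  obtains s t where "0 < s" "s < 1" "0 < t" "t < 1"
    "diagonal_point A B C D = A + s *\<^sub>R (C - A)"
    "diagonal_point A B C D = B + t *\<^sub>R (D - B)"
    "cross2 (C - A) (D - B) \<noteq> 0"
proof -
  let ?u = "C - A" and ?v = "D - B"
  define \<alpha> \<beta> \<gamma> \<delta> where "\<alpha> = signed_triangle_area D A B" and "\<beta> = signed_triangle_area A B C"
    and "\<gamma> = signed_triangle_area B C D" and "\<delta> = signed_triangle_area C D A"
  define S where "S = cross2 ?u ?v / 2"
  define s where "s = \<alpha> / S"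
  define t where "t = \<beta> / S"
  have cyclic: "signed_triangle_area A B D = \<alpha>" "signed_triangle_area B C A = \<beta>"
    "signed_triangle_area C D B = \<gamma>"
    by (simp_all add: signed_triangle_area_def \<alpha>_def \<beta>_def \<gamma>_def algebra_simps)
  have "\<beta> * \<alpha> > 0" "\<gamma> * \<beta> > 0" "\<delta> * \<gamma> > 0"
    using assms unfolding convex_quadrilateral_def same_side_def cyclic \<beta>_def [symmetric]
      \<gamma>_def [symmetric] \<delta>_def [symmetric] by blast+
  then have same_sign: "(\<alpha> > 0 \<and> \<beta> > 0 \<and> \<gamma> > 0 \<and> \<delta> > 0) \<or> (\<alpha> < 0 \<and> \<beta> < 0 \<and> \<gamma> < 0 \<and> \<delta> < 0)"
    by (auto simp: zero_less_mult_iff)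
  have S: "S = \<alpha> + \<gamma>" "S = \<beta> + \<delta>"
    by (simp_all add: S_def \<alpha>_def \<beta>_def \<gamma>_def \<delta>_def cross2_def signed_triangle_area_def field_simps)
  have "S \<noteq> 0" and s: "0 < s" "s < 1" and t: "0 < t" "t < 1"
    using same_sign S by (auto simp: s_def t_def field_simps)
  have nz: "cross2 ?u ?v \<noteq> 0"
    using \<open>S \<noteq> 0\<close> by (simp add: S_def)
  have "S *\<^sub>R A + \<alpha> *\<^sub>R ?u = S *\<^sub>R B + \<beta> *\<^sub>R ?v"
    by (simp add: vec_eq_iff forall_2 S_def \<alpha>_def \<beta>_def cross2_def signed_triangle_area_def field_simps)
  then have "(1 / S) *\<^sub>R (S *\<^sub>R A + \<alpha> *\<^sub>R ?u) = (1 / S) *\<^sub>R (S *\<^sub>R B + \<beta> *\<^sub>R ?v)"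
    by simp
  then have meet: "A + s *\<^sub>R ?u = B + t *\<^sub>R ?v"
    unfolding scaleR_right_distrib scaleR_scaleR using \<open>S \<noteq> 0\<close> by (simp add: s_def t_def)
  have on_segment: "X \<in> closed_segment P Q \<longleftrightarrow> (\<exists>r. 0 \<le> r \<and> r \<le> 1 \<and> X = P + r *\<^sub>R (Q - P))" for X P Q :: "real^2"
    by (auto simp: in_segment algebra_simps)
  have "diagonal_point A B C D = A + s *\<^sub>R ?u"
    unfolding diagonal_point_def
  proof (rule the_equality)
    show "A + s *\<^sub>R ?u \<in> closed_segment A C \<and> A + s *\<^sub>R ?u \<in> closed_segment B D"
      using s t meet less_imp_le unfolding on_segment by metis
  next
    fix X
    assume "X \<in> closed_segment A C \<and> X \<in> closed_segment B D"
    then obtain r r' where r: "X = A + r *\<^sub>R ?u" "X = B + r' *\<^sub>R ?v"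
      unfolding on_segment by blast
    have "(r - s) *\<^sub>R ?u = (r' - t) *\<^sub>R ?v"
    proof -
      have "(r - s) *\<^sub>R ?u = (A + r *\<^sub>R ?u) - (A + s *\<^sub>R ?u)"
        by (simp add: scaleR_left_diff_distrib)
      also have "\<dots> = (B + r' *\<^sub>R ?v) - (B + t *\<^sub>R ?v)"
        using r meet by simp
      also have "\<dots> = (r' - t) *\<^sub>R ?v"
        by (simp add: scaleR_left_diff_distrib)
      finally show ?thesis .
    qed
    then have "cross2 ((r - s) *\<^sub>R ?u) ?v = cross2 ((r' - t) *\<^sub>R ?v) ?v"
      by simp
    then have "r = s"
      using nz by (simp add: cross2_def)
    then show "X = A + s *\<^sub>R ?u"
      using r by simp
  qed
  with s t meet nz show ?thesis
    by (intro that [of s t]) auto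
qed

lemma parallelogram_if_sides_eq:
  assumes "G - F = H - I" "cross2 (G - F) (H - G) \<noteq> 0"
  shows "parallelogram F G H I"
    and "signed_quad_area F G H I = cross2 (G - F) (H - G)"
proof -
  define p q where "p = G - F" and "q = H - G"
  have pts: "G = F + p" "H = F + p + q" "I = F + q"
    using assms(1) by (simp_all add: p_def q_def algebra_simps)
  have areas: "signed_triangle_area F G H = cross2 p q / 2" "signed_triangle_area F G I = cross2 p q / 2"
    "signed_triangle_area G H I = cross2 p q / 2" "signed_triangle_area G H F = cross2 p q / 2"
    "signed_triangle_area H I F = cross2 p q / 2" "signed_triangle_area H I G = cross2 p q / 2"
    "signed_triangle_area I F G = cross2 p q / 2" "signed_triangle_area I F H = cross2 p q / 2"
    unfolding pts by (simp_all add: signed_triangle_area_def cross2_def field_simps)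
  have "convex_quadrilateral F G H I"
    unfolding convex_quadrilateral_def same_side_def areas
    using assms(2) by (auto simp: p_def q_def zero_less_mult_iff)
  moreover have "parallel F G I H" "parallel G H F I"
    unfolding parallel_def pts by (simp_all add: insert_commute)
  ultimately show "parallelogram F G H I"
    by (simp add: parallelogram_def)
  show "signed_quad_area F G H I = cross2 (G - F) (H - G)"
    unfolding signed_quad_area_cross2 unfolding pts by (simp add: cross2_def field_simps)
qed

section \<open>The parallelogram of de Longchamps points\<close>

theorem theorem7p1:
  fixes A B C D E F G H I :: "real^2"
  assumes "convex_quadrilateral A B C D"
    and "E = diagonal_point A B C D"
    and "F = X20 E A B"
    and "G = X20 E B C"
    and "H = X20 E C D"
    and "I = X20 E D A"
  shows "parallelogram F G H I \<and>
         quad_orientation A B C D * signed_quad_area A B C D =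
           1 / 2 * (quad_orientation A B C D * signed_quad_area F G H I)"
proof -
  define u v where "u = C - A" and "v = D - B"
  obtain s t where st: "0 < s" "s < 1" "0 < t" "t < 1"
    and E: "E = A + s *\<^sub>R u" "E = B + t *\<^sub>R v" and nz: "cross2 u v \<noteq> 0"
    using convex_quadrilateral_diagonals [OF assms(1)] unfolding assms(2) u_def v_def by metis
  have nz': "cross2 v u \<noteq> 0"
    using nz cross2_commute [of u v] by simp
  have ends: "C = A + u" "D = B + v"
    by (simp_all add: u_def v_def)
  have pts: "A = E + (- s) *\<^sub>R u" "C = E + (1 - s) *\<^sub>R u" "B = E + (- t) *\<^sub>R v" "D = E + (1 - t) *\<^sub>R v"
    unfolding ends scaleR_left_diff_distrib using E by (simp_all add: eq_diff_eq [symmetric])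
  have coeffs: "- s \<noteq> 0" "1 - s \<noteq> 0" "- t \<noteq> 0" "1 - t \<noteq> 0"
    using st by simp_all
  have F: "F = X20 E A B" "F = X20 E B A" and G: "G = X20 E C B" "G = X20 E B C"
    and H: "H = X20 E C D" "H = X20 E D C" and I: "I = X20 E A D"
    using assms X20_swap by auto
  \<comment> \<open>\<open>F\<close> and \<open>G\<close> share the side \<open>EB\<close>, \<open>I\<close> and \<open>H\<close> the side \<open>ED\<close>: in both cases the third vertex
    moves from \<open>A\<close> to \<open>C\<close>, that is, by \<open>u\<close>.\<close>
  have GF: "(G - F) \<bullet> u = u \<bullet> u" "(G - F) \<bullet> v = - (u \<bullet> v)"
    using X20_diff_inner [OF nz coeffs(1,2,3), of E] unfolding pts [symmetric] G(1) F(1) by simp_all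
  have HI: "(H - I) \<bullet> u = u \<bullet> u" "(H - I) \<bullet> v = - (u \<bullet> v)"
    using X20_diff_inner [OF nz coeffs(1,2,4), of E] unfolding pts [symmetric] H(1) I by simp_all
  \<comment> \<open>\<open>G\<close> and \<open>H\<close> share the side \<open>EC\<close>, and the third vertex moves from \<open>B\<close> to \<open>D\<close>.\<close>
  have HG: "(H - G) \<bullet> v = v \<bullet> v" "(H - G) \<bullet> u = - (u \<bullet> v)"
    using X20_diff_inner [OF nz' coeffs(3,4,2), of E] unfolding pts [symmetric] H(2) G(2)
    by (simp_all add: inner_commute)
  have sides: "G - F = H - I"
    using GF HI by (intro eq_if_inner_eq [OF nz]) simp_all
  have "cross2 (G - F) (H - G) * cross2 u v = cross2 u v * cross2 u v"
    unfolding cross2_gram GF HG by (simp add: inner_commute)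
  then have area: "cross2 (G - F) (H - G) = cross2 u v"
    using nz by simp
  have "parallelogram F G H I" "signed_quad_area F G H I = cross2 u v"
    using parallelogram_if_sides_eq [OF sides] nz unfolding area by simp_all
  moreover have "signed_quad_area A B C D = cross2 u v / 2"
    by (simp add: signed_quad_area_cross2 u_def v_def)
  ultimately show ?thesis
    by simp
qed

end
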